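(* Let $n\in\mathbb{N}$, $p\in(0,1]$, $q=1-p$, and let $\alpha=(\alpha_1,\dots,\alpha_n)\in[n]^n$ satisfy $\alpha_i\le i$ for all $i\in[n]$. Under the probabilistic parking protocol with open boundaries with preference list $\alpha$ and parameter $p$, the expected time for all of the cars to park is $$\mathbb{E}[\tau_\alpha\mid X_\alpha=1]=\begin{cases}\displaystyle\frac13\sum_{i=1}^n(i^2-\alpha_i^2)=\frac{2n^3+3n^2+n}{18}-\frac13\sum_{i=1}^n\alpha_i^2 & \text{if }p=\tfrac12,\\[3mm] \displaystyle\frac1{p-q}\sum_{i=1}^n\left(\frac{i\left(1+(q/p)^i\right)}{1-(q/p)^i}-\frac{\alpha_i\left(1+(q/p)^{\alpha_i}\right)}{1-(q/p)^{\alpha_i}}\right) & \text{otherwise.}\end{cases}$$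
   Context: $[n]=\{1,\dots,n\}$. Preference lists with $\alpha_i\le i$ for all $i$ are exactly the parking functions whose classical outcome is the identity permutation. Probabilistic parking protocol with open boundary: cars $1,2,\dots,n$ arrive one at a time in this order, each entering after its predecessor has finished its search. Car $i$ starts at spot $\alpha_i$ and performs a nearest-neighbour random walk (independent of the walks of the other cars), each step being $+1$ with probability $p$ and $-1$ with probability $q=1-p$, until it either first visits an unoccupied spot of $[n]$, where it parks immediately (in zero steps if $\alpha_i$ is unoccupied), or leaves $[n]$ (enters $0$ or $n+1$), in which case its search terminates and it does not park. $X_\alpha$ is the indicator that all $n$ cars park (in which event car $i$ parks in spot $i$ for every $i$). $\tau_\alpha^i$ is the number of steps of car $i$ until it first hits $i$ or $0$, and $\tau_\alpha=\sum_{i=1}^n\tau_\alpha^i$ is the total time. *)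

theory Defs
  imports "HOL-Probability.Probability"
begin

text \<open>
  Spots are integers; the street \<open>[n]\<close> is \<open>{1..int n}\<close>. The protocol is defined for
  a fixed realisation \<open>s\<close> of the steps: \<open>s i t\<close> is the step with index \<open>t\<close> (counted from 0) of
  car \<open>i\<close>. Each car owns an infinite step sequence, of which only the part up to
  the end of its search matters.
\<close>

definition walk :: "nat \<Rightarrow> (nat \<Rightarrow> int) \<Rightarrow> nat \<Rightarrow> int" where
  "walk a s t = int a + (\<Sum>k<t. s k)"

definition search_ends :: "nat \<Rightarrow> int set \<Rightarrow> int \<Rightarrow> bool" where
  "search_ends n occ x \<longleftrightarrow> x \<in> {1..int n} - occ \<or> x \<in> {0, int n + 1}"

text \<open>
  The spot taken by a car with preference \<open>a\<close> when the spots in \<open>occ\<close> are occupied. It is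
  \<open>None\<close> if the car leaves the street, and also if its search never ends.
\<close>

definition park :: "nat \<Rightarrow> int set \<Rightarrow> nat \<Rightarrow> (nat \<Rightarrow> int) \<Rightarrow> int option" where
  "park n occ a s =
     (if \<exists>t. search_ends n occ (walk a s t) then
        (let x = walk a s (LEAST t. search_ends n occ (walk a s t))
         in if x \<in> {1..int n} then Some x else None)
      else None)"

text \<open>The spots occupied once cars \<open>1, \<dots>, i\<close> have finished their searches.\<close>

primrec occupied :: "nat \<Rightarrow> (nat \<Rightarrow> nat) \<Rightarrow> (nat \<Rightarrow> nat \<Rightarrow> int) \<Rightarrow> nat \<Rightarrow> int set" where
  "occupied n \<alpha> s 0 = {}"
| "occupied n \<alpha> s (Suc i) =
     occupied n \<alpha> s i \<union> set_option (park n (occupied n \<alpha> s i) (\<alpha> (Suc i)) (s (Suc i)))"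

definition outcome :: "nat \<Rightarrow> (nat \<Rightarrow> nat) \<Rightarrow> (nat \<Rightarrow> nat \<Rightarrow> int) \<Rightarrow> nat \<Rightarrow> int option" where
  "outcome n \<alpha> s i = park n (occupied n \<alpha> s (i - 1)) (\<alpha> i) (s i)"

definition all_park :: "nat \<Rightarrow> (nat \<Rightarrow> nat) \<Rightarrow> (nat \<Rightarrow> nat \<Rightarrow> int) \<Rightarrow> bool" where
  "all_park n \<alpha> s \<longleftrightarrow> (\<forall>i\<in>{1..n}. outcome n \<alpha> s i \<noteq> None)"

text \<open>The value is \<open>\<infinity>\<close> (infimum of the empty set) if neither \<open>i\<close> nor \<open>0\<close> is ever hit.\<close>

definition car_time :: "(nat \<Rightarrow> nat) \<Rightarrow> (nat \<Rightarrow> nat \<Rightarrow> int) \<Rightarrow> nat \<Rightarrow> enat" where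
  "car_time \<alpha> s i = Inf (enat ` {t. walk (\<alpha> i) (s i) t \<in> {int i, 0}})"

definition total_time :: "nat \<Rightarrow> (nat \<Rightarrow> nat) \<Rightarrow> (nat \<Rightarrow> nat \<Rightarrow> int) \<Rightarrow> enat" where
  "total_time n \<alpha> s = (\<Sum>i=1..n. car_time \<alpha> s i)"

text \<open>
  Expectation of a nonnegative, possibly infinite random variable conditional on the event \<open>A\<close>,
  that is, with respect to the conditional probability measure \<open>B \<mapsto> P(A \<inter> B) / P(A)\<close>.
\<close>

definition cond_expectation :: "'w measure \<Rightarrow> 'w set \<Rightarrow> ('w \<Rightarrow> ennreal) \<Rightarrow> ennreal" where
  "cond_expectation M A Y = (\<integral>\<^sup>+\<omega>. Y \<omega> \<partial>uniform_measure M A)"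

end

theory Submission imports Defs begin

text \<open>
  Because \<open>\<alpha> i \<le> i\<close>, the cars can all park only by filling the street from left to right. When car
  \<open>i\<close> arrives the spots below \<open>i\<close> are then exactly the occupied ones, and the car parks if
  and only if its walk reaches \<open>i\<close> before \<open>0\<close> (lemma \<open>all_park_iff_wins\<close>). So the conditioning event
  is an intersection of independent events, one for each car, and conditionally on it the expected
  total time is the sum over the cars of the conditional mean duration of a gambler's ruin walk
  that starts at \<open>\<alpha> i\<close> and wins at \<open>i\<close> (lemma \<open>cond_expectation_total_time\<close>).

  For one walk on \<open>{0..N}\<close> with exit time \<open>\<tau>\<close>, let \<open>h\<close> be the winning probability and
  \<open>g = E[\<tau>; win]\<close>. Conditioning on the first step gives linear recurrences for both, with \<open>h\<close>
  as the source term for \<open>g\<close>. The closed forms solve these recurrences (lemmas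
  \<open>win_prob_recurrence\<close> and \<open>win_duration_recurrence\<close>). To see that they are the probabilistic
  quantities, and that \<open>g\<close> is finite, both are expanded into series over the exit time. The
  remainders are iterates of the one-step averaging operator killed at the boundary, which decay
  geometrically by a Lyapunov function that works for every \<open>p > 0\<close> (lemma
  \<open>killed_step_geometric_decay\<close>). The terms of the series are the probabilities of winning at
  a given time, again by conditioning on the first step (lemma \<open>prob_wins\<close>).
\<close>

section \<open>Exit from an interval: killed iterates and generating series\<close>

text \<open>
  Averaging over one step of the walk that is killed on leaving \<open>{1..N - 1}\<close>: if \<open>\<tau>\<close> is the
  first time the walk started at \<open>x\<close> is in \<open>{0, N}\<close>, then the \<open>T\<close>-fold iterate maps \<open>\<phi>\<close> to
  \<open>E[\<phi>(W\<^sub>T); T \<le> \<tau>]\<close>.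
\<close>

definition killed_step :: "real \<Rightarrow> nat \<Rightarrow> (nat \<Rightarrow> real) \<Rightarrow> nat \<Rightarrow> real" where
  "killed_step p N \<phi> x =
     (if 0 < x \<and> x < N then p * \<phi> (x + 1) + (1 - p) * \<phi> (x - 1) else 0)"

text \<open>
  The function \<open>1 + B ^ N - B ^ x\<close> is a Lyapunov function on \<open>{0..N}\<close>. Since \<open>B = 2 / p\<close>, the
  upward step alone contributes \<open>2 * B ^ x\<close> to the next mean of \<open>B ^ x\<close>, so at interior points the function drops by at least 1 in the
  mean, whatever the sign of the drift of the walk. Its values lie between \<open>1\<close> and \<open>B ^ N\<close>, and a loss
  of 1 is therefore a loss of a fixed proportion.
\<close>

lemma killed_step_geometric_decay:
  assumes p: "0 < p" "p \<le> 1"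
  obtains D \<rho> where "0 \<le> \<rho>" "\<rho> < 1"
    "\<And>T x. x \<le> N \<Longrightarrow> \<bar>(killed_step p N ^^ T) \<phi> x\<bar> \<le> D * \<rho> ^ T"
proof -
  define B where "B = 2 / p"
  define m where "m x = 1 + B ^ N - B ^ x" for x
  define \<rho> where "\<rho> = 1 - 1 / (B ^ N)"
  define L where "L = Max ((\<lambda>x. \<bar>\<phi> x\<bar>) ` {..N})"
  have B: "B \<ge> 1" "p * B = 2" using p by (auto simp: B_def field_simps)
  have BN: "B ^ N \<ge> 1" using B by (simp add: one_le_power)
  have \<rho>: "0 \<le> \<rho>" "\<rho> < 1" using BN by (auto simp: \<rho>_def field_simps)
  have L: "\<bar>\<phi> x\<bar> \<le> L" if "x \<le> N" for x
    unfolding L_def using that by (intro Max_ge) auto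
  have L0: "0 \<le> L" using L[of 0] by simp
  have m: "1 \<le> m x" "m x \<le> B ^ N" if "x \<le> N" for x
    using that B power_increasing[of x N B] one_le_power[of B x] by (auto simp: m_def)
  have drift: "p * m (x + 1) + (1 - p) * m (x - 1) \<le> \<rho> * m x" if x: "0 < x" "x < N" for x
  proof -
    have "p * m (x + 1) + (1 - p) * m (x - 1)
        = 1 + B ^ N - (p * B) * B ^ x - (1 - p) * B ^ (x - 1)"
      by (simp add: m_def algebra_simps)
    also have "\<dots> \<le> 1 + B ^ N - 2 * B ^ x"
      using p B by simp
    also have "\<dots> \<le> m x - 1"
      using one_le_power[of B x] B by (simp add: m_def)
    also have "\<dots> \<le> \<rho> * m x"
      using m[of x] x BN by (simp add: \<rho>_def field_simps)
    finally show ?thesis .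
  qed
  have bound: "\<bar>(killed_step p N ^^ T) \<phi> x\<bar> \<le> L * \<rho> ^ T * m x" if "x \<le> N" for T x
    using that
  proof (induction T arbitrary: x)
    case 0
    have "L * 1 \<le> L * m x" using L0 m[OF 0] by (intro mult_left_mono) auto
    then show ?case using L[OF 0] by simp
  next
    case (Suc T)
    let ?\<psi> = "(killed_step p N ^^ T) \<phi>"
    show ?case
    proof (cases "0 < x \<and> x < N")
      case True
      have "\<bar>(killed_step p N ^^ Suc T) \<phi> x\<bar> = \<bar>p * ?\<psi> (x + 1) + (1 - p) * ?\<psi> (x - 1)\<bar>"
        using True by (simp add: killed_step_def)
      also have "\<dots> \<le> p * \<bar>?\<psi> (x + 1)\<bar> + (1 - p) * \<bar>?\<psi> (x - 1)\<bar>"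
        using p by (intro order_trans[OF abs_triangle_ineq]) (simp add: abs_mult)
      also have "\<dots> \<le> p * (L * \<rho> ^ T * m (x + 1)) + (1 - p) * (L * \<rho> ^ T * m (x - 1))"
        using p True by (intro add_mono mult_left_mono Suc.IH) auto
      also have "\<dots> = L * \<rho> ^ T * (p * m (x + 1) + (1 - p) * m (x - 1))"
        by (simp add: algebra_simps)
      also have "\<dots> \<le> L * \<rho> ^ T * (\<rho> * m x)"
        using True L0 \<rho> by (intro mult_left_mono drift) auto
      finally show ?thesis by (simp add: mult_ac)
    next
      case False
      then show ?thesis using L0 \<rho> m[OF Suc.prems] by (auto simp: killed_step_def)
    qed
  qed
  show ?thesis
  proof (rule that[OF \<rho>])
    fix T x assume x: "x \<le> N"
    have "L * \<rho> ^ T * m x \<le> L * \<rho> ^ T * B ^ N"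
      using L0 \<rho> m[OF x] by (intro mult_left_mono) auto
    then show "\<bar>(killed_step p N ^^ T) \<phi> x\<bar> \<le> (L * B ^ N) * \<rho> ^ T"
      using bound[OF x, of T] by (simp add: mult_ac)
  qed
qed

text \<open>
  These are the remainder terms in the two series below. The factor \<open>T\<close> is harmless because the
  decay is geometric.
\<close>

lemma killed_step_tendsto_0:
  assumes p: "0 < p" "p \<le> 1" and x: "x \<le> N"
  shows "(\<lambda>T. (killed_step p N ^^ T) \<phi> x) \<longlonglongrightarrow> 0"
    and "(\<lambda>T. real T * (killed_step p N ^^ T) \<phi> x) \<longlonglongrightarrow> 0"
proof -
  obtain D \<rho> where \<rho>: "0 \<le> \<rho>" "\<rho> < 1"
    and b: "\<And>T. \<bar>(killed_step p N ^^ T) \<phi> x\<bar> \<le> D * \<rho> ^ T"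
    using killed_step_geometric_decay[OF p] x by metis
  have "(\<lambda>T. D * \<rho> ^ T) \<longlonglongrightarrow> 0"
    using \<rho> by (intro tendsto_mult_right_zero LIMSEQ_power_zero) auto
  then show "(\<lambda>T. (killed_step p N ^^ T) \<phi> x) \<longlonglongrightarrow> 0"
    by (rule Lim_null_comparison[rotated]) (use b in auto)
  have "(\<lambda>T. D * (real T * \<rho> ^ T)) \<longlonglongrightarrow> 0"
    using \<rho> by (intro tendsto_mult_right_zero powser_times_n_limit_0) auto
  moreover have "\<forall>T. norm (real T * (killed_step p N ^^ T) \<phi> x) \<le> D * (real T * \<rho> ^ T)"
  proof
    fix T
    show "norm (real T * (killed_step p N ^^ T) \<phi> x) \<le> D * (real T * \<rho> ^ T)"
      using mult_left_mono[OF b[of T], of "real T"] by (simp add: abs_mult mult.left_commute)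
  qed
  ultimately show "(\<lambda>T. real T * (killed_step p N ^^ T) \<phi> x) \<longlonglongrightarrow> 0"
    by (rule Lim_null_comparison[OF always_eventually, rotated])
qed

lemma killed_step_funpow_add:
  "(killed_step p N ^^ T) (\<lambda>x. \<phi> x + \<psi> x) x
     = (killed_step p N ^^ T) \<phi> x + (killed_step p N ^^ T) \<psi> x"
  by (induction T arbitrary: x) (simp_all add: killed_step_def algebra_simps)

lemma killed_step_funpow_cong:
  assumes "\<And>x. x \<le> N \<Longrightarrow> \<phi> x = \<psi> x" "x \<le> N"
  shows "(killed_step p N ^^ T) \<phi> x = (killed_step p N ^^ T) \<psi> x"
  using assms(2) by (induction T arbitrary: x) (simp_all add: killed_step_def assms(1))

text \<open>
  By the description of the iterates of \<^const>\<open>killed_step\<close>, this is the probability that the walk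
  from \<open>x \<le> N\<close> visits \<open>{0, N}\<close> for the first time at time \<open>t\<close> and is then at \<open>N\<close>; \<open>prob_wins\<close> below
  establishes this for random walks.
\<close>

definition win_at :: "real \<Rightarrow> nat \<Rightarrow> nat \<Rightarrow> nat \<Rightarrow> real" where
  "win_at p N x t = (killed_step p N ^^ t) (\<lambda>y. of_bool (y = N)) x"

lemma win_at_nonneg: "0 \<le> p \<Longrightarrow> p \<le> 1 \<Longrightarrow> 0 \<le> win_at p N x t"
  unfolding win_at_def
  by (induction t arbitrary: x) (simp_all add: killed_step_def)

text \<open>
  First-step analysis determines the winning probability: unrolling the equation for \<open>h\<close> \<open>T\<close> times
  leaves \<open>h\<close> as a partial sum plus the \<open>T\<close>-th iterate applied to \<open>h\<close>, which vanishes in the limit.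
\<close>

lemma win_at_sums:
  assumes p: "0 < p" "p \<le> 1" and x: "x \<le> N"
    and h: "\<And>y. y \<le> N \<Longrightarrow> h y = of_bool (y = N) + killed_step p N h y"
  shows "win_at p N x sums h x"
proof -
  have "h x - (\<Sum>t<T. win_at p N x t) = (killed_step p N ^^ T) h x" for T
  proof (induction T)
    case (Suc T)
    have "(killed_step p N ^^ T) h x
        = (killed_step p N ^^ T) (\<lambda>y. of_bool (y = N) + killed_step p N h y) x"
      using h x by (intro killed_step_funpow_cong) auto
    then show ?case
      using Suc by (simp add: killed_step_funpow_add win_at_def funpow_swap1)
  qed simp
  then have "(\<lambda>T. h x - (\<Sum>t<T. win_at p N x t)) \<longlonglongrightarrow> 0"
    using killed_step_tendsto_0(1)[OF p x, of h] by simp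
  from tendsto_diff[OF tendsto_const[of "h x"] this] show ?thesis
    by (simp add: sums_def)
qed

text \<open>
  Let \<open>\<tau>\<close> be the exit time and \<open>h\<close> the winning probability. A function \<open>g\<close> that satisfies the
  first-step equation of \<open>E[\<tau>; win]\<close> is equal to it: a walk still alive at time \<open>T\<close> contributes its
  elapsed time \<open>T\<close> times \<open>h\<close>, plus the remaining time \<open>g\<close>. Hence the error of the \<open>T\<close>-th partial sum
  is \<open>T\<close> times an iterate of \<open>h\<close> plus an iterate of \<open>g\<close>.
\<close>

lemma weighted_win_at_sums:
  assumes p: "0 < p" "p \<le> 1" and x: "x \<le> N"
    and h: "\<And>y. y \<le> N \<Longrightarrow> h y = of_bool (y = N) + killed_step p N h y"
    and g: "\<And>y. y \<le> N \<Longrightarrow> g y = killed_step p N h y + killed_step p N g y"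
  shows "(\<lambda>t. real t * win_at p N x t) sums g x"
proof -
  let ?K = "\<lambda>T. killed_step p N ^^ T"
  have step_h: "?K T h x = win_at p N x T + ?K (Suc T) h x" for T
  proof -
    have "?K T h x = ?K T (\<lambda>y. of_bool (y = N) + killed_step p N h y) x"
      using h x by (intro killed_step_funpow_cong) auto
    then show ?thesis by (simp add: killed_step_funpow_add win_at_def funpow_swap1)
  qed
  have step_g: "?K T g x = ?K (Suc T) h x + ?K (Suc T) g x" for T
  proof -
    have "?K T g x = ?K T (\<lambda>y. killed_step p N h y + killed_step p N g y) x"
      using g x by (intro killed_step_funpow_cong) auto
    then show ?thesis by (simp add: killed_step_funpow_add funpow_swap1)
  qed
  have "g x - (\<Sum>t<T. real t * win_at p N x t) = ?K T g x + real T * ?K T h x" for T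
  proof (induction T)
    case (Suc T)
    then show ?case
      using step_h[of T] step_g[of T] by (simp add: algebra_simps del: funpow.simps)
  qed simp
  then have "(\<lambda>T. g x - (\<Sum>t<T. real t * win_at p N x t)) \<longlonglongrightarrow> 0"
    using tendsto_add[OF killed_step_tendsto_0(1)[OF p x, of g]
                         killed_step_tendsto_0(2)[OF p x, of h]] by simp
  from tendsto_diff[OF tendsto_const[of "g x"] this] show ?thesis
    by (simp add: sums_def)
qed

section \<open>Closed forms for the winning probability and the mean winning time\<close>

definition win_prob :: "real \<Rightarrow> nat \<Rightarrow> nat \<Rightarrow> real" where
  "win_prob p N x = (let r = (1 - p) / p in
     if p = 1/2 then real x / real N else (1 - r ^ x) / (1 - r ^ N))"

text \<open>
  The mean exit time conditional on leaving at \<open>N\<close>. The unconditioned quantity \<open>E[\<tau>; win]\<close> is the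
  product of this with \<^const>\<open>win_prob\<close>. At \<open>x = 0\<close>, where the conditional mean is meaningless, the
  product is 0 because \<^const>\<open>win_prob\<close> is.
\<close>

definition win_duration :: "real \<Rightarrow> nat \<Rightarrow> nat \<Rightarrow> real" where
  "win_duration p N x = (let r = (1 - p) / p in
     if p = 1/2 then ((real N)\<^sup>2 - (real x)\<^sup>2) / 3
     else 1 / (p - (1 - p)) * (real N * (1 + r ^ N) / (1 - r ^ N) - real x * (1 + r ^ x) / (1 - r ^ x)))"

lemma odds_power_neq_1:
  fixes p :: real
  assumes "0 < p" "p \<le> 1" "p \<noteq> 1/2" "0 < k"
  shows "((1 - p) / p) ^ k \<noteq> 1"
proof
  assume "((1 - p) / p) ^ k = 1"
  then have "(1 - p) / p = 1"
    using assms power_eq_iff_eq_base[of k "(1 - p) / p" 1] by simp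
  then show False using assms by (simp add: field_simps)
qed

lemma win_prob_pos:
  assumes "0 < p" "p \<le> 1" "0 < x" "x \<le> N"
  shows "0 < win_prob p N x"
proof (cases "p = 1/2")
  case False
  define r where "r = (1 - p) / p"
  have r: "0 \<le> r" "r \<noteq> 1" using assms False by (auto simp: r_def field_simps)
  have "0 < (1 - r ^ x) / (1 - r ^ N)"
  proof (cases "r < 1")
    case True
    then have "r ^ x < 1" "r ^ N < 1" using r assms by (auto intro: power_less_one_iff[THEN iffD2] simp: power_less_one_iff)
    then show ?thesis by simp
  next
    case False
    then have "r ^ x > 1" "r ^ N > 1" using r assms by (auto intro!: one_less_power)
    then show ?thesis by (intro divide_neg_neg) auto
  qed
  then show ?thesis using False by (simp add: win_prob_def r_def Let_def)
qed (use assms in \<open>simp add: win_prob_def\<close>)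

lemma win_prob_recurrence:
  assumes p: "0 < p" "p \<le> 1" and N: "0 < N" and x: "x \<le> N"
  shows "win_prob p N x = of_bool (x = N) + killed_step p N (win_prob p N) x"
proof (cases "0 < x \<and> x < N")
  case False
  then consider "x = 0" | "x = N" using x by linarith
  then show ?thesis
    using N p odds_power_neq_1[of p N] by cases (auto simp: win_prob_def killed_step_def Let_def)
next
  case True
  then obtain y where y: "x = Suc y" by (cases x) auto
  show ?thesis
  proof (cases "p = 1/2")
    case True
    then show ?thesis using \<open>0 < x \<and> x < N\<close> by (simp add: y win_prob_def killed_step_def field_simps)
  next
    case False
    define r where "r = (1 - p) / p"
    have pr: "1 - p = p * r" using p by (simp add: r_def)
    have rN: "1 - r ^ N \<noteq> 0" using odds_power_neq_1[OF p False N] by (simp add: r_def)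
    have p1: "p + p * r = 1" using pr by simp
    have "1 - r ^ x = p * (1 - r ^ (x + 1)) + (1 - p) * (1 - r ^ (x - 1))"
    proof -
      have "1 - r * R = p * (1 - r * (r * R)) + p * r * (1 - R)" for R
        using p1 by algebra
      from this[of "r ^ y"] show ?thesis unfolding pr y by (simp add: mult.assoc)
    qed
    from arg_cong[OF this, of "\<lambda>u. u / (1 - r ^ N)"] show ?thesis
      using False True unfolding win_prob_def killed_step_def Let_def r_def[symmetric]
      by (simp add: add_divide_distrib)
  qed
qed

text \<open>
  Every win from an interior point uses the first step. Its unit of time therefore contributes
  the winning probability, which gives the inhomogeneous term, and the remaining time after the
  first step gives the other one.
\<close>

lemma win_duration_recurrence:
  assumes p: "0 < p" "p \<le> 1" and N: "0 < N" and x: "x \<le> N"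
  defines "g \<equiv> \<lambda>y. win_prob p N y * win_duration p N y"
  shows "g x = killed_step p N (win_prob p N) x + killed_step p N g x"
proof (cases "0 < x \<and> x < N")
  case False
  then consider "x = 0" | "x = N" using x by linarith
  then show ?thesis
    by cases (auto simp: g_def win_prob_def win_duration_def killed_step_def Let_def)
next
  case True
  then obtain y where y: "x = Suc y" by (cases x) auto
  have h: "killed_step p N (win_prob p N) x = win_prob p N x"
    using win_prob_recurrence[OF p N x] True by simp
  show ?thesis
  proof (cases "p = 1/2")
    case half: True
    have "g k = real k * ((real N)\<^sup>2 - (real k)\<^sup>2) / (3 * real N)" for k
      using half by (simp add: g_def win_prob_def win_duration_def)
    moreover have "(Y + 1) * (n\<^sup>2 - (Y + 1)\<^sup>2) / (3 * n)
        = (Y + 1) / n + (1/2 * ((Y + 2) * (n\<^sup>2 - (Y + 2)\<^sup>2) / (3 * n))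
          + 1/2 * (Y * (n\<^sup>2 - Y\<^sup>2) / (3 * n)))" if "n \<noteq> 0" for Y n :: real
      using that by (simp add: divide_simps) (simp add: algebra_simps power2_eq_square)
    from this[of "real N" "real y"] N
    have "real x * ((real N)\<^sup>2 - (real x)\<^sup>2) / (3 * real N)
        = real x / real N
          + (1/2 * (real (x + 1) * ((real N)\<^sup>2 - (real (x + 1))\<^sup>2) / (3 * real N))
          + 1/2 * (real (x - 1) * ((real N)\<^sup>2 - (real (x - 1))\<^sup>2) / (3 * real N)))"
      by (simp add: y add_ac)
    ultimately show ?thesis
      unfolding h using True by (simp only: killed_step_def win_prob_def half) simp
  next
    case False
    define r where "r = (1 - p) / p"
    define c where "c = real N * (1 + r ^ N) / (1 - r ^ N)"
    define d where "d = (p - (1 - p)) * (1 - r ^ N)"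
    have pr: "1 - p = p * r" using p by (simp add: r_def)
    have p1: "p + p * r = 1" using pr by simp
    have rk: "1 - r ^ k \<noteq> 0" if "0 < k" for k
      using odds_power_neq_1[OF p False that] by (simp add: r_def)
    have d: "d \<noteq> 0" "p - (1 - p) \<noteq> 0" using False rk[OF N] by (auto simp: d_def)
    \<comment> \<open>Multiplying by the winning probability clears the denominator that depends on \<open>k\<close>, so that the recurrence becomes a polynomial identity in \<open>r ^ k\<close> and \<open>k\<close>.\<close>
    have g: "g k = (c * (1 - r ^ k) - real k * (1 + r ^ k)) / d" for k
    proof (cases "k = 0")
      case False
      have "u / v * (1 / e * (c - w / u)) = (c * u - w) / (e * v)" if "u \<noteq> 0" for u v e w :: real
        using that by (simp add: right_diff_distrib diff_divide_distrib mult_ac)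
      from this[OF rk] False show ?thesis
        using \<open>p \<noteq> 1/2\<close>
        unfolding g_def win_prob_def win_duration_def Let_def r_def[symmetric] c_def[symmetric] d_def
        by simp
    qed (simp add: g_def win_prob_def Let_def)
    have hx: "win_prob p N x = (p - p * r) * (1 - r ^ x) / d"
      using \<open>p \<noteq> 1/2\<close> d unfolding win_prob_def d_def Let_def r_def[symmetric] pr by simp
    have "c * (1 - r ^ x) - real x * (1 + r ^ x)
        = (p - p * r) * (1 - r ^ x)
          + p * (c * (1 - r ^ (x + 1)) - real (x + 1) * (1 + r ^ (x + 1)))
          + p * r * (c * (1 - r ^ (x - 1)) - real (x - 1) * (1 + r ^ (x - 1)))"
    proof -
      have "(p - p * r) * (1 - r * R)
            + p * (c * (1 - r * (r * R)) - (Y + 2) * (1 + r * (r * R)))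
            + p * r * (c * (1 - R) - Y * (1 + R))
          = (p + p * r) * (c * (1 - r * R) - (Y + 1) * (1 + r * R))" for R Y
        by (simp add: algebra_simps)
      from this[of "r ^ y" "real y"] show ?thesis unfolding p1 by (simp add: y add_ac)
    qed
    then show ?thesis
      unfolding h hx using True by (simp add: killed_step_def g pr flip: add_divide_distrib)
  qed
qed

section \<open>From parking to independent exit problems\<close>

text \<open>
  A win at time \<open>t\<close> in the gambler's ruin problem on \<open>{0..N}\<close>, with initial fortune \<open>a\<close>.
\<close>

definition wins :: "nat \<Rightarrow> nat \<Rightarrow> (nat \<Rightarrow> int) \<Rightarrow> nat \<Rightarrow> bool" where
  "wins N a s t \<longleftrightarrow> walk a s t = int N \<and> (\<forall>k<t. walk a s k \<notin> {0, int N})"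

lemma walk_0 [simp]: "walk a s 0 = int a"
  by (simp add: walk_def)

lemma walk_Suc: "walk a s (Suc t) = walk a s t + s t"
  by (simp add: walk_def)

lemma walk_Suc_shift: "int b = int a + s 0 \<Longrightarrow> walk a s (Suc t) = walk b (\<lambda>k. s (Suc k)) t"
  by (simp add: walk_def sum.lessThan_Suc_shift del: sum.lessThan_Suc)

lemma wins_0 [simp]: "wins N a s 0 \<longleftrightarrow> a = N"
  by (auto simp: wins_def)

lemma wins_boundary [simp]: "a = 0 \<or> a = N \<Longrightarrow> \<not> wins N a s (Suc t)"
  by (auto simp: wins_def)

text \<open>
  The first-step recursion. It matches the unrolling of the iterates in \<^const>\<open>win_at\<close>: the first
  application of \<^const>\<open>killed_step\<close> is the first step of the walk.
\<close>

lemma wins_Suc: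
  assumes "0 < a" "a < N" "int b = int a + s 0"
  shows "wins N a s (Suc t) \<longleftrightarrow> wins N b (\<lambda>k. s (Suc k)) t"
proof -
  have "(\<forall>k<Suc t. walk a s k \<notin> {0, int N}) \<longleftrightarrow> (\<forall>k<t. walk a s (Suc k) \<notin> {0, int N})"
    unfolding All_less_Suc2 using assms(1,2) by simp
  then show ?thesis
    unfolding wins_def walk_Suc_shift[of b a s, OF assms(3)] by simp
qed

lemma wins_unique: "wins N a s t \<Longrightarrow> wins N a s u \<Longrightarrow> t = u"
  by (rule linorder_cases[of t u]) (auto simp: wins_def)

text \<open>
  A nearest-neighbour walk cannot jump over \<open>0\<close> or \<open>N\<close>.
\<close>

lemma walk_stays_between:
  assumes "\<And>t. s t \<in> {1, -1}" "a \<le> N" "\<And>k. k < t \<Longrightarrow> walk a s k \<notin> {0, int N}"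
  shows "walk a s t \<in> {0..int N}"
  using assms(3)
proof (induction t)
  case (Suc t)
  then have "walk a s t \<in> {0..int N}" "walk a s t \<notin> {0, int N}" by auto
  then show ?case using assms(1)[of t] by (auto simp: walk_Suc)
qed (use assms(2) in simp)

text \<open>
  If exactly the spots below \<open>N\<close> are occupied, then the search of a car that has not passed \<open>0\<close> or
  \<open>N\<close> ends where it meets one of the two. This is why the time in the theorem is the
  hitting time of \<open>{i, 0}\<close>.
\<close>

lemma search_ends_prefix:
  assumes "1 \<le> N" "N \<le> n" "x \<in> {0..int N}"
  shows "search_ends n {1..int N - 1} x \<longleftrightarrow> x \<in> {0, int N}"
  using assms by (auto simp: search_ends_def)

lemma park_if_wins:
  assumes s: "\<And>t. s t \<in> {1, -1}" and N: "1 \<le> N" "N \<le> n" and a: "a \<le> N"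
    and w: "wins N a s t"
  shows "park n {1..int N - 1} a s = Some (int N)"
proof -
  let ?e = "\<lambda>t. search_ends n {1..int N - 1} (walk a s t)"
  have e: "?e k \<longleftrightarrow> walk a s k \<in> {0, int N}" if "k \<le> t" for k
  proof (rule search_ends_prefix[OF N walk_stays_between[OF s a]])
    show "walk a s j \<notin> {0, int N}" if "j < k" for j
      using w that \<open>k \<le> t\<close> by (auto simp: wins_def)
  qed
  have "?e t" using e[of t] w unfolding wins_def by blast
  moreover have "\<not> ?e k" if "k < t" for k
    using e[of k] that w unfolding wins_def by (meson less_imp_le)
  ultimately have t: "?e t" "\<And>k. k < t \<Longrightarrow> \<not> ?e k" .
  then have least: "(LEAST t. ?e t) = t"
    by (metis (mono_tags, lifting) Least_equality not_le)
  have ex: "\<exists>t. ?e t" using t(1) by blast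
  have x: "walk a s t = int N" using w by (simp add: wins_def)
  show ?thesis
    unfolding park_def least x Let_def using ex N by simp
qed

lemma wins_if_park:
  assumes s: "\<And>t. s t \<in> {1, -1}" and N: "1 \<le> N" "N \<le> n" and a: "a \<le> N"
    and some: "park n {1..int N - 1} a s \<noteq> None"
  shows "\<exists>t. wins N a s t"
proof -
  let ?e = "\<lambda>t. search_ends n {1..int N - 1} (walk a s t)"
  define t where "t = (LEAST t. ?e t)"
  have ex: "\<exists>t. ?e t" and x: "walk a s t \<in> {1..int n}"
    using some by (auto simp: park_def t_def Let_def split: if_splits)
  have et: "?e t" unfolding t_def using ex by (rule LeastI_ex)
  have before: "walk a s k \<notin> {0, int N}" if "k < t" for k
    using not_less_Least[OF that[unfolded t_def]] N by (auto simp: search_ends_def)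
  have "walk a s t \<in> {0, int N}"
    using search_ends_prefix[OF N walk_stays_between[OF s a before]] et by blast
  then have "wins N a s t" using x before by (auto simp: wins_def)
  then show ?thesis ..
qed

lemma occupied_if_wins:
  assumes s: "\<And>i t. i \<in> {1..n} \<Longrightarrow> s i t \<in> {1, -1}" and \<alpha>: "\<And>i. i \<in> {1..n} \<Longrightarrow> \<alpha> i \<le> i"
    and "m \<le> n" "\<And>i. i \<in> {1..m} \<Longrightarrow> \<exists>t. wins i (\<alpha> i) (s i) t"
  shows "occupied n \<alpha> s m = {1..int m}"
  using assms(3,4)
proof (induction m)
  case (Suc m)
  then have IH: "occupied n \<alpha> s m = {1..int m}" by simp
  obtain t where "wins (Suc m) (\<alpha> (Suc m)) (s (Suc m)) t" using Suc.prems(2)[of "Suc m"] by auto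
  then have "park n {1..int (Suc m) - 1} (\<alpha> (Suc m)) (s (Suc m)) = Some (int (Suc m))"
    using Suc.prems(1) s \<alpha> by (intro park_if_wins) auto
  then show ?case using IH by auto
qed simp

text \<open>
  As \<open>\<alpha> i \<le> i\<close>, the cars fill the street from left to right: as long as all cars have parked, car
  \<open>i\<close> finds the spots \<open>1, \<dots>, i - 1\<close> occupied and can only park in spot \<open>i\<close>. Thus the
  event that all cars park splits into one event for each car, and these involve disjoint
  sets of steps.
\<close>

lemma all_park_iff_wins:
  assumes s: "\<And>i t. i \<in> {1..n} \<Longrightarrow> s i t \<in> {1, -1}" and \<alpha>: "\<And>i. i \<in> {1..n} \<Longrightarrow> \<alpha> i \<le> i"
  shows "all_park n \<alpha> s \<longleftrightarrow> (\<forall>i\<in>{1..n}. \<exists>t. wins i (\<alpha> i) (s i) t)"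
proof -
  have outcome: "outcome n \<alpha> s i \<noteq> None \<longleftrightarrow> (\<exists>t. wins i (\<alpha> i) (s i) t)"
    if i: "i \<in> {1..n}" and w: "\<And>j. j \<in> {1..n} \<Longrightarrow> j < i \<Longrightarrow> \<exists>t. wins j (\<alpha> j) (s j) t" for i
  proof -
    have "occupied n \<alpha> s (i - 1) = {1..int (i - 1)}"
      using i w by (intro occupied_if_wins s \<alpha>) auto
    then have "outcome n \<alpha> s i = park n {1..int i - 1} (\<alpha> i) (s i)"
      using i by (simp add: outcome_def of_nat_diff)
    then show ?thesis
      using park_if_wins[of "s i" i n "\<alpha> i"] wins_if_park[of "s i" i n "\<alpha> i"] i s[OF i] \<alpha>[OF i]
      by auto
  qed
  show ?thesis
  proof
    assume all: "all_park n \<alpha> s"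
    have "i \<in> {1..n} \<longrightarrow> (\<exists>t. wins i (\<alpha> i) (s i) t)" for i
      using all by (induction i rule: less_induct) (metis outcome all_park_def)
    then show "\<forall>i\<in>{1..n}. \<exists>t. wins i (\<alpha> i) (s i) t" by blast
  next
    assume "\<forall>i\<in>{1..n}. \<exists>t. wins i (\<alpha> i) (s i) t"
    then show "all_park n \<alpha> s" using outcome unfolding all_park_def by blast
  qed
qed

lemma car_time_if_wins: "wins i (\<alpha> i) (s i) t \<Longrightarrow> car_time \<alpha> s i = enat t"
  unfolding car_time_def wins_def
  by (intro antisym Inf_greatest Inf_lower) (force simp: not_less[symmetric])+

section \<open>Measurability\<close>

lemma measurable_walk:
  assumes "\<And>t. (\<lambda>x. s x t) \<in> measurable M (count_space UNIV)"
  shows "(\<lambda>x. walk a (s x) t) \<in> measurable M (count_space UNIV)"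
proof (induction t)
  case (Suc t)
  have "(\<lambda>x. (\<lambda>i. i + s x t) (walk a (s x) t)) \<in> measurable M (count_space UNIV)"
    by (rule measurable_compose_countable[OF _ Suc])
       (rule measurable_compose[OF assms], simp)
  then show ?case by (simp add: walk_Suc)
qed simp

lemma measurable_wins:
  assumes "\<And>t. (\<lambda>x. s x t) \<in> measurable M (count_space UNIV)"
  shows "Measurable.pred M (\<lambda>x. wins N a (s x) t)"
proof -
  have w: "Measurable.pred M (\<lambda>x. Q (walk a (s x) k))" for Q k
    by (rule measurable_compose[OF measurable_walk[OF assms]]) simp
  have "Measurable.pred M (\<lambda>x. \<forall>k\<in>{..<t}. walk a (s x) k \<notin> {0, int N})"
    by (intro pred_intros_finite(3) finite_lessThan) (rule w[of "\<lambda>y. y \<notin> {0, int N}"])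
  from pred_intros_logic(3)[OF w[of "\<lambda>y. y = int N" t] this] show ?thesis
    by (simp add: wins_def Ball_def)
qed

lemma measurable_park:
  assumes "\<And>t. (\<lambda>x. s x t) \<in> measurable M (count_space UNIV)"
  shows "(\<lambda>x. park n occ a (s x)) \<in> measurable M (count_space UNIV)"
proof -
  let ?e = "\<lambda>x t. search_ends n occ (walk a (s x) t)"
  have e: "Measurable.pred M (\<lambda>x. ?e x t)" for t
    by (rule measurable_compose[OF measurable_walk[OF assms]]) simp
  have "(\<lambda>x. walk a (s x) (LEAST t. ?e x t)) \<in> measurable M (count_space UNIV)"
    by (rule measurable_compose_countable[where f = "\<lambda>t x. walk a (s x) t"
          and g = "\<lambda>x. LEAST t. ?e x t", OF measurable_walk[OF assms] measurable_Least[OF e]])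
  then have "(\<lambda>x. (\<lambda>y. if y \<in> {1..int n} then Some y else None) (walk a (s x) (LEAST t. ?e x t)))
      \<in> measurable M (count_space UNIV)"
    by (rule measurable_compose) simp
  from measurable_If[OF this measurable_const pred_intros_countable(2)[OF e, unfolded pred_def]]
  show ?thesis unfolding park_def Let_def by simp
qed

lemma measurable_occupied:
  assumes "\<And>i t. i \<in> {1..n} \<Longrightarrow> (\<lambda>x. s x i t) \<in> measurable M (count_space UNIV)" "m \<le> n"
  shows "(\<lambda>x. occupied n \<alpha> (s x) m) \<in> measurable M (count_space (Pow {1..int n}))"
  using assms(2)
proof (induction m)
  case (Suc m)
  have Sm: "Suc m \<in> {1..n}" using Suc.prems by simp
  have "(\<lambda>x. (\<lambda>occ. occ \<union> set_option (park n occ (\<alpha> (Suc m)) (s x (Suc m)))) (occupied n \<alpha> (s x) m))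
      \<in> measurable M (count_space (Pow {1..int n}))"
  proof (rule measurable_compose_countable'[OF _ Suc.IH])
    fix occ assume "occ \<in> Pow {1..int n}"
    then have "(\<lambda>y. occ \<union> set_option (park n occ (\<alpha> (Suc m)) (s y (Suc m)))) \<in> space M \<rightarrow> Pow {1..int n}"
      by (auto simp: park_def Let_def split: if_splits)
    moreover have "(\<lambda>x. occ \<union> set_option (park n occ (\<alpha> (Suc m)) (s x (Suc m))))
        \<in> measurable M (count_space UNIV)"
      by (rule measurable_compose[OF measurable_park[OF assms(1)[OF Sm]]]) simp
    ultimately show "(\<lambda>x. occ \<union> set_option (park n occ (\<alpha> (Suc m)) (s x (Suc m))))
        \<in> measurable M (count_space (Pow {1..int n}))"
      unfolding measurable_def by auto
  qed (use Suc.prems in \<open>auto intro: countable_finite\<close>)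
  then show ?case by simp
qed simp

text \<open>
  The conditional measure is given by a density that is meaningful only for a measurable
  conditioning event. The set of occupied spots takes finitely many values, so each search can be
  treated for one fixed value at a time.
\<close>

lemma measurable_all_park:
  assumes "\<And>i t. i \<in> {1..n} \<Longrightarrow> (\<lambda>x. s x i t) \<in> measurable M (count_space UNIV)"
  shows "Measurable.pred M (\<lambda>x. all_park n \<alpha> (s x))"
proof -
  have "Measurable.pred M (\<lambda>x. outcome n \<alpha> (s x) i \<noteq> None)" if i: "i \<in> {1..n}" for i
  proof -
    have "(\<lambda>x. (\<lambda>occ. park n occ (\<alpha> i) (s x i)) (occupied n \<alpha> (s x) (i - 1)))
        \<in> measurable M (count_space UNIV)"
      by (rule measurable_compose_countable'[OF measurable_park[OF assms[OF i]] measurable_occupied[OF assms]])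
         (use i in \<open>auto intro: countable_finite\<close>)
    then show ?thesis
      unfolding outcome_def by (rule measurable_compose) simp
  qed
  then show ?thesis unfolding all_park_def by (intro pred_intros_finite) auto
qed

section \<open>The law of a single winning walk\<close>

text \<open>
  The value \<open>\<phi> t\<close> of the winning time \<open>t\<close>, or \<open>0\<close> if there is no win: at most one term of the series
  is nonzero. With \<open>\<phi> = 1\<close> it is the indicator of a win, and with \<open>\<phi> t = t\<close> it is the duration
  restricted to this event. As a series it is integrated termwise.
\<close>

definition win_sum :: "(nat \<Rightarrow> real) \<Rightarrow> nat \<Rightarrow> nat \<Rightarrow> (nat \<Rightarrow> int) \<Rightarrow> ennreal" where
  "win_sum \<phi> N a s = (\<Sum>t. if wins N a s t then ennreal (\<phi> t) else 0)"

lemma win_sum_eq: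
  assumes "wins N a s t"
  shows "win_sum \<phi> N a s = ennreal (\<phi> t)"
proof -
  have "win_sum \<phi> N a s = (\<Sum>u\<in>{t}. if wins N a s u then ennreal (\<phi> u) else 0)"
    unfolding win_sum_def by (rule suminf_finite) (use wins_unique[OF assms] in auto)
  then show ?thesis using assms by simp
qed

lemma win_sum_eq_0: "\<nexists>t. wins N a s t \<Longrightarrow> win_sum \<phi> N a s = 0"
  by (simp add: win_sum_def)

lemma measurable_win_sum:
  assumes "\<And>t. (\<lambda>x. s x t) \<in> measurable M (count_space UNIV)"
  shows "(\<lambda>x. win_sum \<phi> N a (s x)) \<in> borel_measurable M"
proof -
  have [measurable]: "Measurable.pred M (\<lambda>x. wins N a (s x) t)" for t
    by (rule measurable_wins[OF assms])
  show ?thesis unfolding win_sum_def by measurable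
qed

context prob_space
begin

lemma AE_steps:
  fixes Y :: "'a \<Rightarrow> int"
  assumes Y: "random_variable (count_space UNIV) Y"
    and up: "prob {\<omega> \<in> space M. Y \<omega> = 1} = p" and down: "prob {\<omega> \<in> space M. Y \<omega> = -1} = 1 - p"
  shows "AE \<omega> in M. Y \<omega> \<in> {1, -1}"
proof -
  have "prob ({\<omega> \<in> space M. Y \<omega> = 1} \<union> {\<omega> \<in> space M. Y \<omega> = -1}) = 1"
    using Y up down by (subst finite_measure_Union) auto
  from AE_prob_1[OF this] show ?thesis by (auto elim: eventually_mono)
qed

lemma prob_wins_step:
  fixes X :: "nat \<Rightarrow> 'a \<Rightarrow> int"
  assumes indep: "indep_vars (\<lambda>_. count_space UNIV) X UNIV"
  shows "prob {\<omega> \<in> space M. X m \<omega> = c \<and> wins N b (\<lambda>k. X (Suc (m + k)) \<omega>) t}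
    = prob {\<omega> \<in> space M. X m \<omega> = c} * prob {\<omega> \<in> space M. wins N b (\<lambda>k. X (Suc (m + k)) \<omega>) t}"
proof -
  let ?W = "\<lambda>f. wins N b (\<lambda>k. f (Suc (m + k))) t"
  have "indep_var (count_space UNIV) ((\<lambda>f. f m = c) \<circ> (\<lambda>\<omega>. restrict (\<lambda>i. X i \<omega>) {m}))
      (count_space UNIV) (?W \<circ> (\<lambda>\<omega>. restrict (\<lambda>i. X i \<omega>) {m<..}))"
  proof (rule indep_var_compose[OF indep_var_restrict[OF indep]])
    show "?W \<in> measurable (PiM {m<..} (\<lambda>_. count_space UNIV)) (count_space UNIV)"
      by (intro measurable_wins measurable_component_singleton) simp
    show "(\<lambda>f. f m = c) \<in> measurable (PiM {m} (\<lambda>_. count_space UNIV)) (count_space UNIV)"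
      by (rule measurable_compose[OF measurable_component_singleton]) simp_all
  qed auto
  from indep_varD[OF this, of "{True}" "{True}"] show ?thesis
    by (simp add: vimage_def Int_def conj_commute)
qed

text \<open>
  First-step analysis by induction on the time. The offset \<open>m\<close> is generalised because after one
  step the same question is asked about the sequence from \<open>m + 1\<close> onwards.
\<close>

lemma prob_wins:
  fixes X :: "nat \<Rightarrow> 'a \<Rightarrow> int"
  assumes indep: "indep_vars (\<lambda>_. count_space UNIV) X UNIV"
    and up: "\<And>t. prob {\<omega> \<in> space M. X t \<omega> = 1} = p"
    and down: "\<And>t. prob {\<omega> \<in> space M. X t \<omega> = -1} = 1 - p"
    and a: "a \<le> N"
  shows "prob {\<omega> \<in> space M. wins N a (\<lambda>k. X (m + k) \<omega>) t} = win_at p N a t"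
  using a
proof (induction t arbitrary: a m)
  case 0
  then show ?case by (simp add: win_at_def prob_space)
next
  case (Suc t)
  have X [measurable]: "random_variable (count_space UNIV) (X k)" for k
    using indep by (auto simp: indep_vars_def)
  show ?case
  proof (cases "0 < a \<and> a < N")
    case False
    then have "a = 0 \<or> a = N" using Suc.prems by linarith
    then show ?thesis by (auto simp: win_at_def killed_step_def)
  next
    case True
    let ?W = "\<lambda>b \<omega>. wins N b (\<lambda>k. X (Suc (m + k)) \<omega>) t"
    have [measurable]: "Measurable.pred M (\<lambda>\<omega>. wins N b (\<lambda>k. X (f k) \<omega>) u)" for b u f
      by (rule measurable_wins) measurable
    let ?U = "\<lambda>c b. {\<omega> \<in> space M. X m \<omega> = c \<and> ?W b \<omega>}"
    have up_step: "wins N a (\<lambda>k. X (m + k) \<omega>) (Suc t) \<longleftrightarrow> ?W (a + 1) \<omega>" if "X m \<omega> = 1" for \<omega>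
      using wins_Suc[of a N "a + 1" "\<lambda>k. X (m + k) \<omega>"] True that by simp
    have down_step: "wins N a (\<lambda>k. X (m + k) \<omega>) (Suc t) \<longleftrightarrow> ?W (a - 1) \<omega>" if "X m \<omega> = -1" for \<omega>
      using wins_Suc[of a N "a - 1" "\<lambda>k. X (m + k) \<omega>"] True that by (simp add: of_nat_diff)
    have IH: "prob {\<omega> \<in> space M. ?W b \<omega>} = win_at p N b t" if "b \<le> N" for b
      using Suc.IH[OF that, of "Suc m"] by simp
    have "prob {\<omega> \<in> space M. wins N a (\<lambda>k. X (m + k) \<omega>) (Suc t)} = prob (?U 1 (a + 1) \<union> ?U (-1) (a - 1))"
    proof (rule finite_measure_eq_AE)
      show "AE \<omega> in M. (\<omega> \<in> {\<omega> \<in> space M. wins N a (\<lambda>k. X (m + k) \<omega>) (Suc t)})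
          = (\<omega> \<in> ?U 1 (a + 1) \<union> ?U (-1) (a - 1))"
        using AE_steps[OF X up down, of m]
        by eventually_elim (auto simp: up_step down_step)
    qed measurable
    also have "\<dots> = prob (?U 1 (a + 1)) + prob (?U (-1) (a - 1))"
      by (rule finite_measure_Union) auto
    also have "\<dots> = p * win_at p N (a + 1) t + (1 - p) * win_at p N (a - 1) t"
      using IH[of "a + 1"] IH[of "a - 1"] conjunct2[OF True] by (simp add: prob_wins_step[OF indep] up down)
    also have "\<dots> = win_at p N a (Suc t)"
      using True by (simp add: win_at_def killed_step_def)
    finally show ?thesis .
  qed
qed

lemma nn_integral_win_sum:
  fixes X :: "nat \<Rightarrow> 'a \<Rightarrow> int"
  assumes indep: "indep_vars (\<lambda>_. count_space UNIV) X UNIV"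
    and up: "\<And>t. prob {\<omega> \<in> space M. X t \<omega> = 1} = p"
    and down: "\<And>t. prob {\<omega> \<in> space M. X t \<omega> = -1} = 1 - p"
    and p: "0 \<le> p" "p \<le> 1" and a: "a \<le> N" and \<phi>: "\<And>t. 0 \<le> \<phi> t"
    and sums: "(\<lambda>t. \<phi> t * win_at p N a t) sums S"
  shows "(\<integral>\<^sup>+\<omega>. win_sum \<phi> N a (\<lambda>t. X t \<omega>) \<partial>M) = ennreal S"
proof -
  have X [measurable]: "random_variable (count_space UNIV) (X k)" for k
    using indep by (auto simp: indep_vars_def)
  have [measurable]: "Measurable.pred M (\<lambda>\<omega>. wins N a (\<lambda>t. X t \<omega>) t)" for t
    by (rule measurable_wins) measurable
  let ?W = "\<lambda>t. {\<omega> \<in> space M. wins N a (\<lambda>t. X t \<omega>) t}"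
  have "(\<integral>\<^sup>+\<omega>. win_sum \<phi> N a (\<lambda>t. X t \<omega>) \<partial>M)
      = (\<Sum>t. \<integral>\<^sup>+\<omega>. (if wins N a (\<lambda>t. X t \<omega>) t then ennreal (\<phi> t) else 0) \<partial>M)"
    unfolding win_sum_def by (rule nn_integral_suminf) measurable
  also have "\<dots> = (\<Sum>t. \<integral>\<^sup>+\<omega>. ennreal (\<phi> t) * indicator (?W t) \<omega> \<partial>M)"
    by (intro suminf_cong nn_integral_cong) auto
  also have "\<dots> = (\<Sum>t. ennreal (\<phi> t * win_at p N a t))"
    using prob_wins[OF indep up down a, of 0] p \<phi>
    by (simp add: nn_integral_cmult_indicator emeasure_eq_measure ennreal_mult win_at_nonneg)
  also have "\<dots> = ennreal S"
    using p \<phi> by (intro suminf_ennreal_eq sums mult_nonneg_nonneg win_at_nonneg) auto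
  finally show ?thesis .
qed

section \<open>Independent cars\<close>

lemma indep_vars_row:
  assumes "indep_vars (\<lambda>_. count_space UNIV) (\<lambda>(i, t). \<xi> i t) (I \<times> UNIV)" "i \<in> I"
  shows "indep_vars (\<lambda>_. count_space UNIV) (\<xi> i) UNIV"
proof -
  have "indep_vars (\<lambda>t. PiM {(i, t)} (\<lambda>_. count_space UNIV))
      (\<lambda>t \<omega>. restrict (\<lambda>j. (case j of (i, t) \<Rightarrow> \<xi> i t) \<omega>) {(i, t)}) UNIV"
    using assms(2) by (intro indep_vars_restrict[OF assms(1)]) (auto simp: disjoint_family_on_def)
  from indep_vars_compose2[OF this, of "\<lambda>t f. f (i, t)" "\<lambda>_. count_space UNIV"]
  show ?thesis by (simp add: measurable_component_singleton)
qed

text \<open>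
  The walks of different cars use disjoint blocks of the independent steps. So functionals of them,
  one for each car, are independent, and the expectation of the product factorises.
\<close>

lemma nn_integral_prod_win_sum:
  fixes \<xi> :: "nat \<Rightarrow> nat \<Rightarrow> 'a \<Rightarrow> int"
  assumes indep: "indep_vars (\<lambda>_. count_space UNIV) (\<lambda>(i, t). \<xi> i t) (I \<times> UNIV)" and I: "finite I"
    and up: "\<And>i t. i \<in> I \<Longrightarrow> prob {\<omega> \<in> space M. \<xi> i t \<omega> = 1} = p"
    and down: "\<And>i t. i \<in> I \<Longrightarrow> prob {\<omega> \<in> space M. \<xi> i t \<omega> = -1} = 1 - p"
    and p: "0 \<le> p" "p \<le> 1" and \<alpha>: "\<And>i. i \<in> I \<Longrightarrow> \<alpha> i \<le> i" and \<phi>: "\<And>i t. 0 \<le> \<phi> i t"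
    and sums: "\<And>i. i \<in> I \<Longrightarrow> (\<lambda>t. \<phi> i t * win_at p i (\<alpha> i) t) sums S i"
  shows "(\<integral>\<^sup>+\<omega>. (\<Prod>i\<in>I. win_sum (\<phi> i) i (\<alpha> i) (\<lambda>t. \<xi> i t \<omega>)) \<partial>M) = ennreal (\<Prod>i\<in>I. S i)"
proof -
  have "indep_vars (\<lambda>i. PiM ({i} \<times> UNIV) (\<lambda>_. count_space UNIV))
      (\<lambda>i \<omega>. restrict (\<lambda>j. (case j of (i, t) \<Rightarrow> \<xi> i t) \<omega>) ({i} \<times> UNIV)) I"
    by (intro indep_vars_restrict[OF indep]) (auto simp: disjoint_family_on_def)
  from indep_vars_compose2[OF this, of "\<lambda>i f. win_sum (\<phi> i) i (\<alpha> i) (\<lambda>t. f (i, t))" "\<lambda>_. borel"]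
  have "indep_vars (\<lambda>_. borel) (\<lambda>i \<omega>. win_sum (\<phi> i) i (\<alpha> i) (\<lambda>t. \<xi> i t \<omega>)) I"
    by (simp add: measurable_win_sum measurable_component_singleton)
  then have "(\<integral>\<^sup>+\<omega>. (\<Prod>i\<in>I. win_sum (\<phi> i) i (\<alpha> i) (\<lambda>t. \<xi> i t \<omega>)) \<partial>M)
      = (\<Prod>i\<in>I. \<integral>\<^sup>+\<omega>. win_sum (\<phi> i) i (\<alpha> i) (\<lambda>t. \<xi> i t \<omega>) \<partial>M)"
    using I by (intro indep_vars_nn_integral) auto
  also have "\<dots> = (\<Prod>i\<in>I. ennreal (S i))"
    by (intro prod.cong refl nn_integral_win_sum[OF indep_vars_row[OF indep] up down p \<alpha> \<phi> sums])
  also have "\<dots> = ennreal (\<Prod>i\<in>I. S i)"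
  proof (rule prod_ennreal)
    show "0 \<le> S i" if "i \<in> I" for i
      using sums[OF that] \<phi> p win_at_nonneg[OF p]
      by (metis (no_types, lifting) mult_nonneg_nonneg sums_le sums_zero)
  qed
  finally show ?thesis .
qed

lemma AE_parking_steps:
  fixes \<xi> :: "nat \<Rightarrow> nat \<Rightarrow> 'a \<Rightarrow> int"
  assumes indep: "indep_vars (\<lambda>_. count_space UNIV) (\<lambda>(i, t). \<xi> i t) (I \<times> UNIV)" and I: "finite I"
    and up: "\<And>i t. i \<in> I \<Longrightarrow> prob {\<omega> \<in> space M. \<xi> i t \<omega> = 1} = p"
    and down: "\<And>i t. i \<in> I \<Longrightarrow> prob {\<omega> \<in> space M. \<xi> i t \<omega> = -1} = 1 - p"
  shows "AE \<omega> in M. \<forall>i\<in>I. \<forall>t. \<xi> i t \<omega> \<in> {1, -1}"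
proof (intro AE_finite_allI[OF I] AE_all_countable[THEN iffD2] allI)
  fix i t assume i: "i \<in> I"
  then have "random_variable (count_space UNIV) (\<xi> i t)"
    using indep_vars_row[OF indep i] by (auto simp: indep_vars_def)
  then show "AE \<omega> in M. \<xi> i t \<omega> \<in> {1, -1}"
    using AE_steps up[OF i] down[OF i] by blast
qed

text \<open>
  On the event that all cars park, the total time is the sum over \<open>i\<close> of \<open>Z i\<close>, the time of car \<open>i\<close>
  times the winning indicators of the other cars. By independence the expectation of \<open>Z i\<close> is the
  probability that all cars park, with the factor of car \<open>i\<close> multiplied by its conditional mean
  duration. Division by that probability leaves the mean duration.
\<close>

lemma cond_expectation_total_time:
  fixes \<xi> :: "nat \<Rightarrow> nat \<Rightarrow> 'a \<Rightarrow> int"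
  assumes indep: "indep_vars (\<lambda>_. count_space UNIV) (\<lambda>(i, t). \<xi> i t) ({1..n} \<times> UNIV)"
    and up: "\<And>i t. i \<in> {1..n} \<Longrightarrow> prob {\<omega> \<in> space M. \<xi> i t \<omega> = 1} = p"
    and down: "\<And>i t. i \<in> {1..n} \<Longrightarrow> prob {\<omega> \<in> space M. \<xi> i t \<omega> = -1} = 1 - p"
    and p: "0 < p" "p \<le> 1" and \<alpha>: "\<And>i. i \<in> {1..n} \<Longrightarrow> 0 < \<alpha> i" "\<And>i. i \<in> {1..n} \<Longrightarrow> \<alpha> i \<le> i"
  shows "cond_expectation M {\<omega> \<in> space M. all_park n \<alpha> (\<lambda>i t. \<xi> i t \<omega>)}
      (\<lambda>\<omega>. ennreal_of_enat (total_time n \<alpha> (\<lambda>i t. \<xi> i t \<omega>)))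
    = ennreal (\<Sum>i=1..n. win_duration p i (\<alpha> i))
    \<and> 0 \<le> (\<Sum>i=1..n. win_duration p i (\<alpha> i))"
proof -
  let ?s = "\<lambda>\<omega> i t. \<xi> i t \<omega>"
  let ?A = "{\<omega> \<in> space M. all_park n \<alpha> (?s \<omega>)}"
  let ?h = "\<lambda>i. win_prob p i (\<alpha> i)" and ?d = "\<lambda>i. win_duration p i (\<alpha> i)"
  define w :: "nat \<Rightarrow> nat \<Rightarrow> nat \<Rightarrow> real" where "w i j t = (if j = i then real t else 1)" for i j t
  define Z where "Z i \<omega> = (\<Prod>j=1..n. win_sum (w i j) j (\<alpha> j) (?s \<omega> j))" for i \<omega>
  have p0: "0 \<le> p" using p by simp
  have \<xi>: "random_variable (count_space UNIV) (\<xi> i t)" if "i \<in> {1..n}" for i t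
    using indep_vars_row[OF indep that] by (auto simp: indep_vars_def)
  have A [measurable]: "?A \<in> sets M"
    using measurable_all_park[of n ?s M \<alpha>] \<xi> by (simp add: pred_def)
  have Z [measurable]: "Z i \<in> borel_measurable M" for i
    unfolding Z_def using \<xi> by (intro borel_measurable_prod_ennreal measurable_win_sum) auto
  have h_sums: "win_at p i (\<alpha> i) sums ?h i" if "i \<in> {1..n}" for i
    using that \<alpha> p by (intro win_at_sums win_prob_recurrence) auto
  have g_sums: "(\<lambda>t. real t * win_at p i (\<alpha> i) t) sums (?h i * ?d i)" if "i \<in> {1..n}" for i
    using that \<alpha> p
    by (intro weighted_win_at_sums[where h = "win_prob p i" and g = "\<lambda>y. win_prob p i y * win_duration p i y"]
          win_prob_recurrence win_duration_recurrence) auto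
  have h_pos: "0 < ?h i" if "i \<in> {1..n}" for i
    using that \<alpha> p by (intro win_prob_pos) auto
  have d_nonneg: "0 \<le> ?d i" if i: "i \<in> {1..n}" for i
  proof -
    have "0 \<le> ?h i * ?d i"
      using g_sums[OF i] win_at_nonneg[OF p0 p(2)]
      by (metis (no_types, lifting) mult_nonneg_nonneg of_nat_0_le_iff sums_le sums_zero)
    then show ?thesis using h_pos[OF i] by (simp add: zero_le_mult_iff)
  qed
  define P where "P = (\<Prod>i=1..n. ?h i)"
  have P_pos: "0 < P" unfolding P_def using h_pos by (intro prod_pos) auto
  have win: "all_park n \<alpha> (?s \<omega>) \<longleftrightarrow> (\<forall>i\<in>{1..n}. \<exists>t. wins i (\<alpha> i) (?s \<omega> i) t)"
    if "\<forall>i\<in>{1..n}. \<forall>t. \<xi> i t \<omega> \<in> {1, -1}" for \<omega>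
    using that \<alpha>(2) by (intro all_park_iff_wins) auto
  have steps: "AE \<omega> in M. \<forall>i\<in>{1..n}. \<forall>t. \<xi> i t \<omega> \<in> {1, -1}"
    using up down by (intro AE_parking_steps[OF indep]) auto
  \<comment> \<open>Without a win of every car, some factor vanishes; hence the products already contain the indicator of the parking event.\<close>
  have lose: "(\<Prod>j=1..n. win_sum (\<phi> j) j (\<alpha> j) (?s \<omega> j)) = 0"
    if "\<not> (\<forall>i\<in>{1..n}. \<exists>t. wins i (\<alpha> i) (?s \<omega> i) t)" for \<omega> \<phi>
    using that win_sum_eq_0 by (intro prod_zero) blast+
  have "emeasure M ?A = (\<integral>\<^sup>+\<omega>. indicator ?A \<omega> \<partial>M)"
    by simp
  also have "\<dots> = (\<integral>\<^sup>+\<omega>. (\<Prod>j=1..n. win_sum (\<lambda>_. 1) j (\<alpha> j) (?s \<omega> j)) \<partial>M)"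
  proof (rule nn_integral_cong_AE)
    have "indicator ?A \<omega> = (\<Prod>j=1..n. win_sum (\<lambda>_. 1) j (\<alpha> j) (?s \<omega> j))"
      if "\<omega> \<in> space M" "\<forall>i\<in>{1..n}. \<forall>t. \<xi> i t \<omega> \<in> {1, -1}" for \<omega>
    proof (cases "\<forall>i\<in>{1..n}. \<exists>t. wins i (\<alpha> i) (?s \<omega> i) t")
      case True
      then have "win_sum (\<lambda>_. 1) j (\<alpha> j) (?s \<omega> j) = 1" if "j \<in> {1..n}" for j
        using that win_sum_eq by fastforce
      then show ?thesis using True that win[of \<omega>] by simp
    qed (use that win[of \<omega>] lose in auto)
    then show "AE \<omega> in M. indicator ?A \<omega> = (\<Prod>j=1..n. win_sum (\<lambda>_. 1) j (\<alpha> j) (?s \<omega> j))"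
      using steps AE_space by (auto elim: eventually_elim2)
  qed
  also have "\<dots> = ennreal P"
    unfolding P_def using h_sums
    by (intro nn_integral_prod_win_sum[OF indep _ up down p0 p(2) \<alpha>(2)]) auto
  finally have PA: "emeasure M ?A = ennreal P" .
  have time: "ennreal_of_enat (total_time n \<alpha> (?s \<omega>)) = (\<Sum>i=1..n. Z i \<omega>)"
    if "\<forall>i\<in>{1..n}. \<exists>t. wins i (\<alpha> i) (?s \<omega> i) t" for \<omega>
  proof -
    from that obtain T where T: "\<And>i. i \<in> {1..n} \<Longrightarrow> wins i (\<alpha> i) (?s \<omega> i) (T i)" by metis
    have "Z i \<omega> = (\<Prod>j=1..n. if j = i then of_nat (T i) else 1)" for i
      unfolding Z_def using win_sum_eq[OF T] by (intro prod.cong) (auto simp: w_def ennreal_of_nat_eq_real_of_nat)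
    then have "Z i \<omega> = of_nat (T i)" if "i \<in> {1..n}" for i
      using that by simp
    moreover have "car_time \<alpha> (?s \<omega>) i = enat (T i)" if "i \<in> {1..n}" for i
      using car_time_if_wins[where s = "?s \<omega>" and \<alpha> = \<alpha>] T[OF that] by blast
    then have "total_time n \<alpha> (?s \<omega>) = enat (\<Sum>i=1..n. T i)"
      unfolding total_time_def by (simp add: of_nat_eq_enat[symmetric])
    ultimately show ?thesis by simp
  qed
  have "cond_expectation M ?A (\<lambda>\<omega>. ennreal_of_enat (total_time n \<alpha> (?s \<omega>)))
      = (\<integral>\<^sup>+\<omega>. (\<Sum>i=1..n. Z i \<omega>) \<partial>uniform_measure M ?A)"
    unfolding cond_expectation_def
  proof (rule nn_integral_cong_AE, rule AE_uniform_measureI[OF A])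
    show "AE \<omega> in M. \<omega> \<in> ?A \<longrightarrow> ennreal_of_enat (total_time n \<alpha> (?s \<omega>)) = (\<Sum>i=1..n. Z i \<omega>)"
      using steps by eventually_elim (use win time in auto)
  qed
  also have "\<dots> = (\<integral>\<^sup>+\<omega>. (\<Sum>i=1..n. Z i \<omega>) * indicator ?A \<omega> \<partial>M) / ennreal P"
    by (simp add: nn_integral_uniform_measure PA)
  also have "(\<integral>\<^sup>+\<omega>. (\<Sum>i=1..n. Z i \<omega>) * indicator ?A \<omega> \<partial>M) = (\<integral>\<^sup>+\<omega>. (\<Sum>i=1..n. Z i \<omega>) \<partial>M)"
  proof (rule nn_integral_cong_AE)
    show "AE \<omega> in M. (\<Sum>i=1..n. Z i \<omega>) * indicator ?A \<omega> = (\<Sum>i=1..n. Z i \<omega>)"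
      using steps AE_space
    proof eventually_elim
      case (elim \<omega>)
      then show ?case
        using win[of \<omega>] lose[of \<omega>] by (cases "\<omega> \<in> ?A") (auto simp: Z_def)
    qed
  qed
  also have "\<dots> = (\<Sum>i=1..n. \<integral>\<^sup>+\<omega>. Z i \<omega> \<partial>M)"
    by (intro nn_integral_sum) simp
  also have "\<dots> = (\<Sum>i=1..n. ennreal (?d i * P))"
  proof (rule sum.cong[OF refl])
    fix i assume i: "i \<in> {1..n}"
    have "(\<integral>\<^sup>+\<omega>. Z i \<omega> \<partial>M) = ennreal (\<Prod>j=1..n. ?h j * (if j = i then ?d i else 1))"
      unfolding Z_def
    proof (intro nn_integral_prod_win_sum[OF indep _ up down p0 p(2) \<alpha>(2)])
      show "(\<lambda>t. w i j t * win_at p j (\<alpha> j) t) sums (?h j * (if j = i then ?d i else 1))"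
        if "j \<in> {1..n}" for j
        using h_sums[OF that] g_sums[OF that] by (auto simp: w_def)
    qed (auto simp: w_def)
    also have "(\<Prod>j=1..n. ?h j * (if j = i then ?d i else 1)) = ?d i * P"
      using i by (simp add: prod.distrib P_def)
    finally show "(\<integral>\<^sup>+\<omega>. Z i \<omega> \<partial>M) = ennreal (?d i * P)" .
  qed
  also have "\<dots> = ennreal ((\<Sum>i=1..n. ?d i) * P)"
    unfolding sum_distrib_right
    by (rule sum_ennreal) (use d_nonneg P_pos in \<open>auto intro: mult_nonneg_nonneg\<close>)
  also have "\<dots> / ennreal P = ennreal (\<Sum>i=1..n. ?d i)"
    using d_nonneg P_pos by (subst divide_ennreal) (auto intro!: mult_nonneg_nonneg sum_nonneg)
  finally show ?thesis using d_nonneg by (auto intro!: sum_nonneg)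
qed

end

section \<open>The expected parking time\<close>

theorem corollary4p4:
  fixes n :: nat and p q :: real and \<alpha> :: "nat \<Rightarrow> nat"
    and M :: "'w measure" and \<xi> :: "nat \<Rightarrow> nat \<Rightarrow> 'w \<Rightarrow> int"
  assumes "0 < p" and "p \<le> 1" and "q = 1 - p"
    and "\<alpha> \<in> {1..n} \<rightarrow> {1..n}" and "\<And>i. i \<in> {1..n} \<Longrightarrow> \<alpha> i \<le> i"
    and "prob_space M"
    and "prob_space.indep_vars M (\<lambda>_. count_space UNIV) (\<lambda>(i, t). \<xi> i t) ({1..n} \<times> UNIV)"
    and "\<And>i t. i \<in> {1..n} \<Longrightarrow> measure M {\<omega> \<in> space M. \<xi> i t \<omega> = 1} = p"
    and "\<And>i t. i \<in> {1..n} \<Longrightarrow> measure M {\<omega> \<in> space M. \<xi> i t \<omega> = -1} = q"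
  defines "E \<equiv> cond_expectation M {\<omega> \<in> space M. all_park n \<alpha> (\<lambda>i t. \<xi> i t \<omega>)}
                 (\<lambda>\<omega>. ennreal_of_enat (total_time n \<alpha> (\<lambda>i t. \<xi> i t \<omega>)))"
  shows "(p = 1/2 \<longrightarrow>
            enn2ereal E = ereal (1/3 * (\<Sum>i=1..n. (real i)^2 - (real (\<alpha> i))^2)) \<and>
            1/3 * (\<Sum>i=1..n. (real i)^2 - (real (\<alpha> i))^2) =
              (2 * real n ^ 3 + 3 * real n ^ 2 + real n) / 18
                - 1/3 * (\<Sum>i=1..n. (real (\<alpha> i))^2)) \<and>
         (p \<noteq> 1/2 \<longrightarrow>
            enn2ereal E = ereal (1 / (p - q) *
              (\<Sum>i=1..n. real i * (1 + (q/p)^i) / (1 - (q/p)^i)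
                - real (\<alpha> i) * (1 + (q/p)^(\<alpha> i)) / (1 - (q/p)^(\<alpha> i)))))"
proof -
  interpret prob_space M by fact
  let ?D = "\<Sum>i=1..n. win_duration p i (\<alpha> i)"
  have pos: "0 < \<alpha> i" if "i \<in> {1..n}" for i
    using assms(4) that by (auto dest!: funcset_mem)
  have "E = ennreal ?D \<and> 0 \<le> ?D"
    unfolding E_def
    by (rule cond_expectation_total_time) (use assms pos in auto)
  then have E: "enn2ereal E = ereal ?D"
    by (simp add: enn2ereal_ennreal)
  show ?thesis
  proof (intro conjI impI)
    assume half: "p = 1/2"
    show "enn2ereal E = ereal (1/3 * (\<Sum>i=1..n. (real i)^2 - (real (\<alpha> i))^2))"
      unfolding E by (simp add: win_duration_def half sum_distrib_left)
    have "(\<Sum>i=1..n. (real i)\<^sup>2) = (2 * real n ^ 3 + 3 * real n ^ 2 + real n) / 6"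
      by (induction n) (simp_all add: field_simps power2_eq_square power3_eq_cube)
    then show "1/3 * (\<Sum>i=1..n. (real i)^2 - (real (\<alpha> i))^2) =
              (2 * real n ^ 3 + 3 * real n ^ 2 + real n) / 18
                - 1/3 * (\<Sum>i=1..n. (real (\<alpha> i))^2)"
      by (simp add: sum_subtractf field_simps)
  next
    assume "p \<noteq> 1/2"
    then show "enn2ereal E = ereal (1 / (p - q) *
              (\<Sum>i=1..n. real i * (1 + (q/p)^i) / (1 - (q/p)^i)
                - real (\<alpha> i) * (1 + (q/p)^(\<alpha> i)) / (1 - (q/p)^(\<alpha> i))))"
      unfolding E assms(3) by (simp add: win_duration_def Let_def sum_distrib_left)
  qed
qed

end
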